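(* Let $0<\varepsilon_a<1$, $0<\varepsilon_r<1$, $0<\delta<1$, $\zeta>0$ and $\rho>0$. Let $\nu=\dfrac{\varepsilon_r}{\varepsilon_a[(1+\varepsilon_r)\ln(1+\varepsilon_r)-\varepsilon_r]}$ and $\tau=\left\lceil\dfrac{\ln\nu}{\ln(1+\rho)}\right\rceil$, and let $n_1<n_2<\cdots<n_s$ be the ascending arrangement of all distinct elements of $$\left\{\left\lceil\nu^{\frac{i}{\tau}}\ln\frac{1}{\zeta\delta}\right\rceil : i=0,1,\ldots,\tau\right\}.$$ Let $X_1,X_2,\ldots$ be i.i.d. Poisson random variables with mean $\lambda>0$. For $\ell=1,\ldots,s$ define $K_\ell=\sum_{i=1}^{n_\ell}X_i$, $\widehat{\lambda}_\ell=\frac{K_\ell}{n_\ell}$, $\overline{\lambda}_\ell=\max\left\{\widehat{\lambda}_\ell+\varepsilon_a,\frac{\widehat{\lambda}_\ell}{1-\varepsilon_r}\right\}$ and $\underline{\lambda}_\ell=\min\left\{\widehat{\lambda}_\ell-\varepsilon_a,\frac{\widehat{\lambda}_\ell}{1+\varepsilon_r}\right\}$. Suppose the stopping rule is that sampling is continued until $S_{\mathrm P}(0,K_\ell-1,n_\ell,\underline{\lambda}_\ell)\ge 1-\zeta\delta$ and $S_{\mathrm P}(0,K_\ell,n_\ell,\overline{\lambda}_\ell)\le\zeta\delta$ for some $\ell\in\{1,\ldots,s\}$. Let $\widehat{\lambda}=\frac{\sum_{i=1}^{\mathbf n}X_i}{\mathbf n}$, where $\mathbf n$ is the sample size when the sampling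 is terminated. Then $\Pr\{|\widehat{\lambda}-\lambda|<\varepsilon_a\ \text{or}\ |\widehat{\lambda}-\lambda|<\varepsilon_r\lambda \mid \lambda\}\ge1-\delta$ for any $\lambda\in(0,\infty)$, provided that $0<\zeta\le\frac{1}{2(\tau+1)}$.
   Context: For integers $k,l$, a positive integer $n$ and real $\lambda$, $S_{\mathrm P}(k,l,n,\lambda)=\sum_{i=k}^{l}\frac{(n\lambda)^ie^{-n\lambda}}{i!}$ if $\lambda>0$ (an empty sum being $0$), and $S_{\mathrm P}(k,l,n,\lambda)=0$ if $\lambda\le0$. The notation $\Pr\{\cdot\mid\lambda\}$ indicates that the samples $X_1,X_2,\ldots$ have parameter $\lambda$. The sampling proceeds through stages $\ell=1,2,\ldots,s$, where at stage $\ell$ a total of $n_\ell$ samples has been observed; it terminates at the first stage $\ell$ at which both stopping conditions hold, and then $\mathbf n=n_\ell$ and $\widehat{\lambda}=\widehat{\lambda}_\ell$.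
   Formalization: The stopping conditions can fail at every stage (e.g. if all observed samples are zero, since S_P = 0 for nonpositive parameter), leaving the final sample size undefined; in that case sampling is taken to end at the last stage, with sample size n_s. *)

theory Defs
  imports "HOL-Probability.Probability"
begin

(* Terms with negative index i vanish (1/i! = 0), so the range of summation is cut at 0. *)
definition S_P :: "int \<Rightarrow> int \<Rightarrow> nat \<Rightarrow> real \<Rightarrow> real" where
  "S_P k l n lam =
     (if lam > 0
      then (\<Sum>i\<in>{max k 0..l}. (real n * lam) ^ nat i * exp (- (real n * lam)) / fact (nat i))
      else 0)"

definition nu :: "real \<Rightarrow> real \<Rightarrow> real" where
  "nu \<epsilon>a \<epsilon>r = \<epsilon>r / (\<epsilon>a * ((1 + \<epsilon>r) * ln (1 + \<epsilon>r) - \<epsilon>r))"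

(* For 0 < \<epsilon>a < 1, 0 < \<epsilon>r < 1 and \<rho> > 0 one has nu > 1, so the ceiling is positive and
   nat does not truncate; likewise for the sample sizes below when 0 < \<zeta> * \<delta> < 1. *)
definition tau :: "real \<Rightarrow> real \<Rightarrow> real \<Rightarrow> nat" where
  "tau \<epsilon>a \<epsilon>r \<rho> = nat \<lceil>ln (nu \<epsilon>a \<epsilon>r) / ln (1 + \<rho>)\<rceil>"

definition sample_sizes :: "real \<Rightarrow> real \<Rightarrow> real \<Rightarrow> real \<Rightarrow> real \<Rightarrow> nat set" where
  "sample_sizes \<epsilon>a \<epsilon>r \<delta> \<zeta> \<rho> =
     (\<lambda>i. nat \<lceil>nu \<epsilon>a \<epsilon>r powr (real i / real (tau \<epsilon>a \<epsilon>r \<rho>)) * ln (1 / (\<zeta> * \<delta>))\<rceil>)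
       ` {0..tau \<epsilon>a \<epsilon>r \<rho>}"

definition sample_sum :: "(nat \<Rightarrow> 'a \<Rightarrow> nat) \<Rightarrow> nat \<Rightarrow> 'a \<Rightarrow> nat" where
  "sample_sum X m \<omega> = (\<Sum>i=1..m. X i \<omega>)"

definition sample_mean :: "(nat \<Rightarrow> 'a \<Rightarrow> nat) \<Rightarrow> nat \<Rightarrow> 'a \<Rightarrow> real" where
  "sample_mean X m \<omega> = real (sample_sum X m \<omega>) / real m"

definition upper_limit :: "real \<Rightarrow> real \<Rightarrow> real \<Rightarrow> real" where
  "upper_limit \<epsilon>a \<epsilon>r x = max (x + \<epsilon>a) (x / (1 - \<epsilon>r))"

definition lower_limit :: "real \<Rightarrow> real \<Rightarrow> real \<Rightarrow> real" where
  "lower_limit \<epsilon>a \<epsilon>r x = min (x - \<epsilon>a) (x / (1 + \<epsilon>r))"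

definition stop_cond ::
  "real \<Rightarrow> real \<Rightarrow> real \<Rightarrow> real \<Rightarrow> (nat \<Rightarrow> 'a \<Rightarrow> nat) \<Rightarrow> nat \<Rightarrow> 'a \<Rightarrow> bool" where
  "stop_cond \<epsilon>a \<epsilon>r \<delta> \<zeta> X m \<omega> \<longleftrightarrow>
     S_P 0 (int (sample_sum X m \<omega>) - 1) m (lower_limit \<epsilon>a \<epsilon>r (sample_mean X m \<omega>)) \<ge> 1 - \<zeta> * \<delta> \<and>
     S_P 0 (int (sample_sum X m \<omega>)) m (upper_limit \<epsilon>a \<epsilon>r (sample_mean X m \<omega>)) \<le> \<zeta> * \<delta>"

(* The stopping conditions may fail at all stages: if lower_limit \<le> 0, then S_P is 0 and the
   first condition is false.  As there are only s stages, sampling then ends with stage s. *)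
definition final_stage :: "nat \<Rightarrow> (nat \<Rightarrow> bool) \<Rightarrow> nat" where
  "final_stage s D =
     (if \<exists>l\<in>{1..s}. D l then (LEAST l. l \<in> {1..s} \<and> D l) else s)"

definition final_size ::
  "real \<Rightarrow> real \<Rightarrow> real \<Rightarrow> real \<Rightarrow> (nat \<Rightarrow> nat) \<Rightarrow> nat \<Rightarrow> (nat \<Rightarrow> 'a \<Rightarrow> nat) \<Rightarrow> 'a \<Rightarrow> nat" where
  "final_size \<epsilon>a \<epsilon>r \<delta> \<zeta> n s X \<omega> =
     n (final_stage s (\<lambda>l. stop_cond \<epsilon>a \<epsilon>r \<delta> \<zeta> X (n l) \<omega>))"

end

theory Submission
  imports Defs
begin

text \<open>
  Deviations at a given stage are controlled in two ways. If the sampling stops there because both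
  stopping conditions hold, then an estimate that is too large has lower limit at least the true
  mean, so the Poisson tail probability of the observed sum is at most \<open>\<zeta> * \<delta>\<close>; such sums form an
  event of probability at most \<open>\<zeta> * \<delta>\<close>, and symmetrically for estimates that are too small. At the
  last stage the sampling may end although the conditions fail, but there the sample size is at
  least \<open>\<nu> * ln (1 / (\<zeta> * \<delta>))\<close>, so Chernoff bounds with tilts \<open>1 + \<epsilon>r\<close> and \<open>1 - \<epsilon>r\<close> give
  the same estimate unconditionally. A union bound over at most \<open>\<tau> + 1\<close> stages concludes.
\<close>

section \<open>Poisson distributions\<close>

text \<open>If \<open>c\<close> is the least element of \<open>T\<close>, then \<open>T\<close> lies
  in the complement of \<open>{..<c}\<close>, so the hypothesis at \<open>c\<close> alone gives the
  bound. It will be applied to the sums that pass the first stopping condition.\<close>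

lemma measure_pmf_le_of_lower_tails:
  fixes p :: "nat pmf"
  assumes "0 \<le> \<alpha>" and "\<And>k. k \<in> T \<Longrightarrow> 1 - \<alpha> \<le> measure p {..<k}"
  shows "measure p T \<le> \<alpha>"
proof (cases "T = {}")
  case False
  define c where "c = (LEAST k. k \<in> T)"
  have c: "c \<in> T" "T \<subseteq> UNIV - {..<c}"
    using False LeastI_ex[of "\<lambda>k. k \<in> T"] Least_le[of "\<lambda>k. k \<in> T"]
    by (auto simp: c_def dest: leD)
  have "measure p T \<le> measure p (UNIV - {..<c})"
    using c by (intro measure_pmf.finite_measure_mono) auto
  also have "\<dots> = 1 - measure p {..<c}"
    using measure_pmf.prob_compl[of "{..<c}" p] by simp
  finally show ?thesis using assms(2)[OF c(1)] by linarith
qed (use assms in simp)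

text \<open>Mirror image for the second stopping condition: \<open>T\<close> lies below its maximum,
  which finiteness provides.\<close>

lemma measure_pmf_le_of_atMost:
  fixes p :: "nat pmf"
  assumes "0 \<le> \<alpha>" and "finite T" and "\<And>k. k \<in> T \<Longrightarrow> measure p {..k} \<le> \<alpha>"
  shows "measure p T \<le> \<alpha>"
proof (cases "T = {}")
  case False
  have "measure p T \<le> measure p {..Max T}"
    using assms(2) by (intro measure_pmf.finite_measure_mono) auto
  also have "\<dots> \<le> \<alpha>"
    using assms(2,3) False by simp
  finally show ?thesis .
qed (use assms in simp)

lemma measure_poisson_lessThan:
  assumes "0 < x"
  shows "measure (poisson_pmf x) {..<k} = (\<Sum>i<k. x ^ i / fact i) * exp (- x)"
  using assms by (simp add: measure_measure_pmf_finite sum_distrib_right)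

text \<open>Telescoping: the derivative of each Poisson term is the preceding term minus the term
  itself, so only the last one survives, with a minus sign.\<close>

lemma sum_exp_terms_deriv:
  "((\<lambda>x::real. (\<Sum>i<Suc k. x ^ i / fact i) * exp (- x)) has_real_derivative
     - (x ^ k / fact k * exp (- x))) (at x)"
proof (induction k)
  case 0
  show ?case by (auto intro!: derivative_eq_intros)
next
  case (Suc k)
  have pow: "((\<lambda>x::real. x ^ Suc k / fact (Suc k)) has_real_derivative x ^ k / fact k) (at x)"
    by (rule DERIV_cong[OF DERIV_cdivide[OF DERIV_pow]])
       (simp add: divide_simps del: of_nat_Suc)
  have ex: "((\<lambda>x::real. exp (- x)) has_real_derivative - exp (- x)) (at x)"
    by (auto intro!: derivative_eq_intros)
  have "((\<lambda>x::real. (\<Sum>i<Suc k. x ^ i / fact i) * exp (- x) + x ^ Suc k / fact (Suc k) * exp (- x))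
      has_real_derivative - (x ^ k / fact k * exp (- x)) +
        (x ^ k / fact k * exp (- x) - x ^ Suc k / fact (Suc k) * exp (- x))) (at x)"
    using DERIV_mult[OF pow ex] by (intro DERIV_add Suc.IH) (simp add: algebra_simps)
  then show ?case
    by (simp add: algebra_simps)
qed

text \<open>The derivative in the mean is minus a Poisson mass, hence nonpositive. This carries the
  stopping conditions from the confidence limits over to the true mean.\<close>

lemma measure_poisson_lessThan_antimono:
  assumes "0 < x" "x \<le> y"
  shows "measure (poisson_pmf y) {..<k} \<le> measure (poisson_pmf x) {..<k}"
proof (cases k)
  case (Suc j)
  have "(\<Sum>i<Suc j. y ^ i / fact i) * exp (- y) \<le> (\<Sum>i<Suc j. x ^ i / fact i) * exp (- x)"
  proof (rule DERIV_nonpos_imp_nonincreasing[OF assms(2)])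
    fix z assume z: "x \<le> z" "z \<le> y"
    show "\<exists>d. ((\<lambda>x. (\<Sum>i<Suc j. x ^ i / fact i) * exp (- x)) has_real_derivative d) (at z) \<and> d \<le> 0"
      by (intro exI conjI, rule sum_exp_terms_deriv) (use z assms in simp)
  qed
  then show ?thesis
    using assms by (simp only: Suc measure_poisson_lessThan)
qed (use assms in simp)

text \<open>Exponential tilting by \<open>y\<close> turns the Poisson distribution with mean \<open>x\<close> into the one
  with mean \<open>x * y\<close>, which replaces the computation of the moment generating function.\<close>
lemma poisson_chernoff:
  assumes "0 < x" "0 < y" and "\<And>k. k \<in> T \<Longrightarrow> 1 \<le> B * y ^ k" and "0 \<le> B"
  shows "measure (poisson_pmf x) T \<le> B * exp (x * (y - 1))"
proof -
  have "measure (poisson_pmf x) T \<le> infsetsum (\<lambda>k. (B * exp (x * (y - 1))) * pmf (poisson_pmf (x * y)) k) T"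
    unfolding measure_pmf_conv_infsetsum
  proof (intro infsetsum_mono pmf_abs_summable abs_summable_on_cmult_right)
    fix k assume "k \<in> T"
    have "pmf (poisson_pmf x) k * 1 \<le> pmf (poisson_pmf x) k * (B * y ^ k)"
      using assms(3)[OF \<open>k \<in> T\<close>] by (intro mult_left_mono) auto
    also have "\<dots> = (B * exp (x * (y - 1))) * pmf (poisson_pmf (x * y)) k"
      using assms(1,2) by (simp add: exp_diff exp_minus field_simps)
    finally show "pmf (poisson_pmf x) k \<le> (B * exp (x * (y - 1))) * pmf (poisson_pmf (x * y)) k"
      by simp
  qed
  also have "\<dots> = (B * exp (x * (y - 1))) * measure (poisson_pmf (x * y)) T"
    by (simp add: infsetsum_cmult_right pmf_abs_summable measure_pmf_conv_infsetsum)
  also have "\<dots> \<le> (B * exp (x * (y - 1))) * 1"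
    using assms(4) by (intro mult_left_mono) auto
  finally show ?thesis by simp
qed

text \<open>The upper index \<open>int k - 1\<close> matches the strict tail \<open>{..<k}\<close>;
  for \<open>k = 0\<close> both sides are empty sums. Positivity of \<open>x\<close> excludes the
  default value 0 of \<open>S_P\<close>.\<close>

lemma S_P_eq_measure_poisson:
  assumes "0 < x" "0 < m"
  shows "S_P 0 (int k - 1) m x = measure (poisson_pmf (real m * x)) {..<k}"
proof -
  have "(\<Sum>i\<in>{0..int k - 1}. (real m * x) ^ nat i * exp (- (real m * x)) / fact (nat i))
      = (\<Sum>i<k. (real m * x) ^ i * exp (- (real m * x)) / fact i)"
    by (rule sum.reindex_bij_witness[of _ int nat]) auto
  then show ?thesis
    using assms by (simp add: S_P_def measure_poisson_lessThan sum_distrib_right)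
qed

lemma S_P_eq_measure_poisson_atMost:
  assumes "0 < x" "0 < m"
  shows "S_P 0 (int k) m x = measure (poisson_pmf (real m * x)) {..k}"
  using S_P_eq_measure_poisson[OF assms, of "Suc k"] by (simp add: lessThan_Suc_atMost)

section \<open>The law of the sum of i.i.d. Poisson samples\<close>

lemma (in prob_space) measurable_sample_sum:
  assumes "indep_vars (\<lambda>_. count_space UNIV) X {1..}"
  shows "sample_sum X m \<in> measurable M (count_space UNIV)"
  unfolding sample_sum_def[abs_def] using assms
  by (intro measurable_sum_nat) (auto simp: indep_vars_def)

text \<open>Induction on \<open>m\<close> by convolution and the binomial theorem. The explicit mass
  formula also makes sense for the empty sum, where it reads \<open>0 ^ k / fact k\<close> with
  \<open>0 ^ 0 = 1\<close>, so the induction can start at 0.\<close>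

lemma (in prob_space) prob_sample_sum:
  assumes indep: "indep_vars (\<lambda>_. count_space UNIV) X {1..}"
    and poisson: "\<And>i. i \<ge> 1 \<Longrightarrow> distr M (count_space UNIV) (X i) = measure_pmf (poisson_pmf lam)"
    and lam: "lam > 0"
  shows "prob {\<omega> \<in> space M. sample_sum X m \<omega> = k} =
           (real m * lam) ^ k / fact k * exp (- (real m * lam))"
proof (induction m arbitrary: k)
  case 0
  show ?case by (cases k) (auto simp: sample_sum_def prob_space)
next
  case (Suc m)
  have rv: "X i \<in> measurable M (count_space UNIV)" if "i \<ge> 1" for i
    using indep that by (auto simp: indep_vars_def)
  have X: "prob {\<omega> \<in> space M. X (Suc m) \<omega> = j} = lam ^ j / fact j * exp (- lam)" for j
  proof -
    have "prob {\<omega> \<in> space M. X (Suc m) \<omega> = j} = measure (distr M (count_space UNIV) (X (Suc m))) {j}"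
      using rv[of "Suc m"] by (subst measure_distr) (auto intro!: arg_cong[where f = prob])
    also have "\<dots> = lam ^ j / fact j * exp (- lam)"
      using lam by (simp add: poisson measure_pmf_single)
    finally show ?thesis .
  qed
  \<comment> \<open>The new sample and the old sum are functions of the disjoint coordinate blocks
    \<open>{Suc m}\<close> and \<open>{1..m}\<close>, so they inherit independence.\<close>
  have "indep_var
      (count_space UNIV) ((\<lambda>f. f (Suc m)) \<circ> (\<lambda>\<omega>. restrict (\<lambda>i. X i \<omega>) {Suc m}))
      (count_space UNIV) ((\<lambda>f. \<Sum>i=1..m. f i) \<circ> (\<lambda>\<omega>. restrict (\<lambda>i. X i \<omega>) {1..m}))"
    by (intro indep_var_compose[OF indep_var_restrict[OF indep]] measurable_sum_nat) auto
  also have "(\<lambda>f. f (Suc m)) \<circ> (\<lambda>\<omega>. restrict (\<lambda>i. X i \<omega>) {Suc m}) = X (Suc m)"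
    by auto
  also have "(\<lambda>f. \<Sum>i=1..m. f i) \<circ> (\<lambda>\<omega>. restrict (\<lambda>i. X i \<omega>) {1..m}) = sample_sum X m"
    by (auto simp: sample_sum_def fun_eq_iff intro!: sum.cong)
  finally have ind: "indep_var (count_space UNIV) (X (Suc m)) (count_space UNIV) (sample_sum X m)" .
  have joint: "prob {\<omega> \<in> space M. X (Suc m) \<omega> = i \<and> sample_sum X m \<omega> = j} =
      lam ^ i / fact i * exp (- lam) * ((real m * lam) ^ j / fact j * exp (- (real m * lam)))" for i j
  proof -
    have "prob ((\<lambda>\<omega>. (X (Suc m) \<omega>, sample_sum X m \<omega>)) -` ({i} \<times> {j}) \<inter> space M) =
        prob (X (Suc m) -` {i} \<inter> space M) * prob (sample_sum X m -` {j} \<inter> space M)"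
      by (rule indep_varD[OF ind]) auto
    then show ?thesis
      using X[of i] Suc.IH[of j] by (simp add: vimage_def Int_def conj_commute)
  qed
  have "prob {\<omega> \<in> space M. sample_sum X (Suc m) \<omega> = k} =
      prob (\<Union>i\<in>{..k}. {\<omega> \<in> space M. X (Suc m) \<omega> = i \<and> sample_sum X m \<omega> = k - i})"
    by (intro arg_cong[where f = prob]) (auto simp: sample_sum_def)
  also have "\<dots> = (\<Sum>i\<le>k. prob {\<omega> \<in> space M. X (Suc m) \<omega> = i \<and> sample_sum X m \<omega> = k - i})"
    using rv[of "Suc m"] measurable_sample_sum[OF indep, of m]
    by (intro finite_measure_finite_Union) (auto simp: disjoint_family_on_def)
  \<comment> \<open>Extracting \<open>1 / fact k\<close> turns the two factorials of each product
    into a binomial coefficient.\<close>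
  also have "\<dots> = (\<Sum>i\<le>k. (real (k choose i)) * lam ^ i * (real m * lam) ^ (k - i)) / fact k
      * exp (- (real (Suc m) * lam))"
    unfolding sum_divide_distrib sum_distrib_right joint
    by (intro sum.cong refl) (auto simp: binomial_fact exp_add[symmetric] field_simps exp_minus)
  also have "\<dots> = (real (Suc m) * lam) ^ k / fact k * exp (- (real (Suc m) * lam))"
    unfolding binomial_ring[symmetric] by (simp add: algebra_simps)
  finally show ?case .
qed

lemma (in prob_space) distr_sample_sum:
  assumes indep: "indep_vars (\<lambda>_. count_space UNIV) X {1..}"
    and poisson: "\<And>i. i \<ge> 1 \<Longrightarrow> distr M (count_space UNIV) (X i) = measure_pmf (poisson_pmf lam)"
    and lam: "lam > 0" and "m > 0"
  shows "distr M (count_space UNIV) (sample_sum X m) = measure_pmf (poisson_pmf (real m * lam))"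
proof (rule measure_eqI_countable[where A = UNIV])
  fix k :: nat
  have "emeasure (distr M (count_space UNIV) (sample_sum X m)) {k} =
      prob {\<omega> \<in> space M. sample_sum X m \<omega> = k}"
    using measurable_sample_sum[OF indep] by (subst emeasure_distr)
      (auto simp: emeasure_eq_measure intro!: arg_cong[where f = prob])
  also have "\<dots> = pmf (poisson_pmf (real m * lam)) k"
    using prob_sample_sum[OF indep poisson lam] lam \<open>m > 0\<close> by simp
  finally show "emeasure (distr M (count_space UNIV) (sample_sum X m)) {k} =
      emeasure (poisson_pmf (real m * lam)) {k}"
    by (simp add: emeasure_pmf_single)
qed auto

section \<open>Deviations at a single stage\<close>

text \<open>Missing both tolerances means deviating by at least their maximum. Upwards, the absolute
  part gives \<open>lam \<le> x - \<epsilon>a\<close> and the relative part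
  \<open>lam \<le> x / (1 + \<epsilon>r)\<close>, so the lower limit is at least \<open>lam\<close>
  and the tail condition passes to \<open>lam\<close>.\<close>

lemma large_deviation_with_stop_cond:
  assumes "0 \<le> \<alpha>" "0 < \<epsilon>r" "0 < lam" "m > 0"
  shows "measure (poisson_pmf (real m * lam))
     {k. lam + max \<epsilon>a (\<epsilon>r * lam) \<le> real k / real m \<and>
         1 - \<alpha> \<le> S_P 0 (int k - 1) m (lower_limit \<epsilon>a \<epsilon>r (real k / real m))} \<le> \<alpha>"
proof (rule measure_pmf_le_of_lower_tails[OF assms(1)], elim CollectE conjE)
  fix k assume k: "lam + max \<epsilon>a (\<epsilon>r * lam) \<le> real k / real m"
    and S: "1 - \<alpha> \<le> S_P 0 (int k - 1) m (lower_limit \<epsilon>a \<epsilon>r (real k / real m))"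
  define x where "x = real k / real m"
  have "lam \<le> x / (1 + \<epsilon>r)"
    using k assms(2) by (subst pos_le_divide_eq) (auto simp: x_def algebra_simps)
  then have le: "lam \<le> lower_limit \<epsilon>a \<epsilon>r x"
    using k by (auto simp: lower_limit_def x_def)
  have "1 - \<alpha> \<le> measure (poisson_pmf (real m * lower_limit \<epsilon>a \<epsilon>r x)) {..<k}"
    using S le assms(3,4) by (simp add: S_P_eq_measure_poisson x_def)
  also have "\<dots> \<le> measure (poisson_pmf (real m * lam)) {..<k}"
    using le assms(3,4) by (intro measure_poisson_lessThan_antimono) auto
  finally show "1 - \<alpha> \<le> measure (poisson_pmf (real m * lam)) {..<k}" .
qed

lemma small_deviation_with_stop_cond:
  assumes "0 \<le> \<alpha>" "0 < \<epsilon>a" "\<epsilon>r < 1" "m > 0"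
  shows "measure (poisson_pmf (real m * lam))
     {k. real k / real m \<le> lam - max \<epsilon>a (\<epsilon>r * lam) \<and>
         S_P 0 (int k) m (upper_limit \<epsilon>a \<epsilon>r (real k / real m)) \<le> \<alpha>} \<le> \<alpha>" (is "measure _ ?T \<le> _")
proof (rule measure_pmf_le_of_atMost[OF assms(1)])
  have "?T \<subseteq> {..nat \<lceil>lam * real m\<rceil>}"
  proof safe
    fix k assume "real k / real m \<le> lam - max \<epsilon>a (\<epsilon>r * lam)"
    then have "real k / real m \<le> lam" using assms(2) by auto
    then have "real k \<le> lam * real m" using assms(4) by (simp add: field_simps)
    then show "k \<le> nat \<lceil>lam * real m\<rceil>" by linarith
  qed
  then show "finite ?T" by (rule finite_subset) simp
next
  fix k assume "k \<in> ?T"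
  then have k: "real k / real m \<le> lam - max \<epsilon>a (\<epsilon>r * lam)"
    and S: "S_P 0 (int k) m (upper_limit \<epsilon>a \<epsilon>r (real k / real m)) \<le> \<alpha>" by auto
  define x where "x = real k / real m"
  have "0 \<le> x" by (simp add: x_def)
  \<comment> \<open>With a nonpositive limit \<open>S_P\<close> would be 0 and the condition would
    say nothing about a Poisson tail; the shift by \<open>\<epsilon>a\<close> prevents this even for
    \<open>x = 0\<close>.\<close>
  then have pos: "0 < upper_limit \<epsilon>a \<epsilon>r x" using assms(2) by (simp add: upper_limit_def)
  have "x / (1 - \<epsilon>r) \<le> lam"
    using k assms(3) by (subst pos_divide_le_eq) (auto simp: x_def algebra_simps)
  then have le: "upper_limit \<epsilon>a \<epsilon>r x \<le> lam"
    using k by (auto simp: upper_limit_def x_def)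
  have "measure (poisson_pmf (real m * lam)) {..<Suc k}
      \<le> measure (poisson_pmf (real m * upper_limit \<epsilon>a \<epsilon>r x)) {..<Suc k}"
    using le pos assms(4) by (intro measure_poisson_lessThan_antimono) auto
  also have "\<dots> \<le> \<alpha>"
    using S pos assms(4) by (simp add: S_P_eq_measure_poisson_atMost x_def lessThan_Suc_atMost)
  finally show "measure (poisson_pmf (real m * lam)) {..k} \<le> \<alpha>"
    by (simp add: lessThan_Suc_atMost)
qed

section \<open>Entropy inequalities and Chernoff bounds for the last stage\<close>

text \<open>The strict inequality \<open>ln z < z - 1\<close> at \<open>z = 1 / (1 + e)\<close>,
  multiplied by \<open>1 + e\<close>. It makes the denominator of \<open>nu\<close>
  positive.\<close>

lemma ln_one_plus_entropy_pos:
  fixes e :: real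
  assumes "0 < e"
  shows "0 < (1 + e) * ln (1 + e) - e"
proof -
  have "ln (inverse (1 + e)) < inverse (1 + e) - 1"
    using ln_le_minus_one[of "inverse (1 + e)"] ln_eq_minus_one[of "inverse (1 + e)"] assms
    by (smt (verit) inverse_eq_1_iff positive_imp_inverse_positive)
  then have "- ln (1 + e) < inverse (1 + e) - 1"
    using assms by (simp only: ln_inverse)
  then show ?thesis
    using assms by (simp add: field_simps)
qed

text \<open>The difference of the two sides vanishes at 0 and has derivative
  \<open>- ln (1 - x * x) \<ge> 0\<close>. Hence the lower tail decays at least as fast as the upper
  one, and a \<open>nu\<close> built from the upper entropy serves both.\<close>

lemma ln_entropy_le:
  fixes e :: real
  assumes "0 < e" "e < 1"
  shows "(1 + e) * ln (1 + e) - e \<le> (1 - e) * ln (1 - e) + e"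
proof -
  let ?f = "\<lambda>e::real. (1 - e) * ln (1 - e) + e - ((1 + e) * ln (1 + e) - e)"
  have "?f 0 \<le> ?f e"
  proof (rule DERIV_nonneg_imp_nondecreasing[where f = ?f])
    fix x :: real assume x: "0 \<le> x" "x \<le> e"
    have "(?f has_real_derivative - ln (1 - x) - ln (1 + x)) (at x)"
      using x assms by (auto intro!: derivative_eq_intros)
    moreover have "ln (1 - x) + ln (1 + x) = ln (1 - x * x)"
      using x assms ln_mult[of "1 - x" "1 + x"] by (simp add: algebra_simps)
    moreover have "ln (1 - x * x) \<le> 0"
      using x assms mult_strict_mono[of x 1 x 1] by (intro ln_le_zero_iff[THEN iffD2]) auto
    ultimately show "\<exists>y. (?f has_real_derivative y) (at x) \<and> 0 \<le> y"
      by (intro exI conjI) auto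
  qed (use assms in simp)
  then show ?thesis by simp
qed

text \<open>\<open>1 / nu\<close> is the exponential rate per sample of the upper Chernoff bound at
  the mean \<open>\<epsilon>a / \<epsilon>r\<close>, where the absolute and relative tolerances
  coincide.\<close>

lemma inverse_nu:
  assumes "0 < \<epsilon>a" "0 < \<epsilon>r"
  shows "1 / nu \<epsilon>a \<epsilon>r = \<epsilon>a / \<epsilon>r * ((1 + \<epsilon>r) * ln (1 + \<epsilon>r) - \<epsilon>r)" and "0 < nu \<epsilon>a \<epsilon>r"
  using assms ln_one_plus_entropy_pos[OF assms(2)] by (auto simp: nu_def)

lemma exp_le_of_sample_size:
  assumes "0 < \<nu>" "0 < \<alpha>" "\<nu> * ln (1 / \<alpha>) \<le> real m" "1 / \<nu> \<le> c"
  shows "exp (- (real m * c)) \<le> \<alpha>"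
proof -
  have "ln (1 / \<alpha>) \<le> real m * (1 / \<nu>)"
    using assms(1,3) by (simp add: field_simps)
  also have "\<dots> \<le> real m * c"
    using assms(4) by (intro mult_left_mono) auto
  finally have "exp (- (real m * c)) \<le> exp (- ln (1 / \<alpha>))" by simp
  also have "\<dots> = \<alpha>" using assms(2) by (simp add: ln_div)
  finally show ?thesis .
qed

text \<open>The tilt \<open>1 + \<epsilon>r\<close> is the same for all \<open>lam\<close>. The
  resulting rate decreases in \<open>lam\<close> while the absolute tolerance dominates and
  increases once the relative one does, so its minimum is at
  \<open>lam = \<epsilon>a / \<epsilon>r\<close> and equals \<open>1 / nu\<close>.\<close>

lemma large_deviation_at_last_stage:
  assumes "0 < \<epsilon>a" "0 < \<epsilon>r" "0 < lam" "m > 0" "0 < \<alpha>"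
    and m: "nu \<epsilon>a \<epsilon>r * ln (1 / \<alpha>) \<le> real m"
  shows "measure (poisson_pmf (real m * lam))
     {k. lam + max \<epsilon>a (\<epsilon>r * lam) \<le> real k / real m} \<le> \<alpha>"
proof -
  define a where "a = max \<epsilon>a (\<epsilon>r * lam)"
  define \<theta> where "\<theta> = ln (1 + \<epsilon>r)"
  have \<theta>: "0 < \<theta>" "\<theta> \<le> \<epsilon>r" "0 \<le> (1 + \<epsilon>r) * \<theta> - \<epsilon>r" "exp \<theta> = 1 + \<epsilon>r"
    using assms(2) ln_add_one_self_le_self[of \<epsilon>r] ln_one_plus_entropy_pos[OF assms(2)]
    by (auto simp: \<theta>_def)
  have rate: "1 / nu \<epsilon>a \<epsilon>r \<le> \<theta> * (lam + a) - lam * \<epsilon>r"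
  proof (cases "\<epsilon>a / \<epsilon>r \<le> lam")
    case True
    have "\<epsilon>a / \<epsilon>r * ((1 + \<epsilon>r) * \<theta> - \<epsilon>r) \<le> lam * ((1 + \<epsilon>r) * \<theta> - \<epsilon>r)"
      using True \<theta> by (intro mult_right_mono) auto
    also have "\<dots> = \<theta> * (lam + \<epsilon>r * lam) - lam * \<epsilon>r" by (simp add: algebra_simps)
    also have "\<dots> \<le> \<theta> * (lam + a) - lam * \<epsilon>r"
      using \<theta> by (simp add: a_def)
    finally show ?thesis using inverse_nu(1)[OF assms(1,2)] by (simp add: \<theta>_def)
  next
    case False
    have "\<epsilon>a / \<epsilon>r * ((1 + \<epsilon>r) * \<theta> - \<epsilon>r) = \<theta> * \<epsilon>a - \<epsilon>a / \<epsilon>r * (\<epsilon>r - \<theta>)"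
      using assms(2) by (simp add: field_simps)
    also have "\<dots> \<le> \<theta> * \<epsilon>a - lam * (\<epsilon>r - \<theta>)"
      using False \<theta> mult_right_mono[of lam "\<epsilon>a / \<epsilon>r" "\<epsilon>r - \<theta>"] by auto
    also have "\<dots> \<le> \<theta> * a - lam * (\<epsilon>r - \<theta>)"
      using \<theta> by (simp add: a_def)
    finally show ?thesis
      using inverse_nu(1)[OF assms(1,2)] by (simp add: \<theta>_def algebra_simps)
  qed
  \<comment> \<open>The prefactor is the reciprocal of
    \<open>(1 + \<epsilon>r) ^ k = exp (k * \<theta>)\<close> at the threshold
    \<open>k = m * (lam + a)\<close>, so the product is at least 1 exactly from there on.\<close>
  have "measure (poisson_pmf (real m * lam)) {k. lam + a \<le> real k / real m}
      \<le> exp (- (\<theta> * (real m * (lam + a)))) * exp (real m * lam * ((1 + \<epsilon>r) - 1))"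
  proof (rule poisson_chernoff)
    fix k assume "k \<in> {k. lam + a \<le> real k / real m}"
    then have "real m * (lam + a) \<le> real k" using assms(4) by (simp add: field_simps)
    then have "\<theta> * (real m * (lam + a)) \<le> real k * \<theta>" using \<theta> by simp
    then have "1 \<le> exp (- (\<theta> * (real m * (lam + a)))) * exp (real k * \<theta>)"
      by (simp add: exp_add[symmetric])
    then show "1 \<le> exp (- (\<theta> * (real m * (lam + a)))) * (1 + \<epsilon>r) ^ k"
      by (simp add: exp_of_nat_mult \<theta>)
  qed (use assms in auto)
  also have "\<dots> = exp (- (real m * (\<theta> * (lam + a) - lam * \<epsilon>r)))"
    by (simp add: exp_add[symmetric] algebra_simps)
  also have "\<dots> \<le> \<alpha>"
    by (rule exp_le_of_sample_size[OF inverse_nu(2)[OF assms(1,2)] assms(5) m rate])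
  finally show ?thesis by (simp add: a_def)
qed

text \<open>The same argument with tilt \<open>1 - \<epsilon>r\<close>; again the rate
  \<open>\<theta> * a - lam * (\<theta> - \<epsilon>r)\<close> is smallest at
  \<open>lam = \<epsilon>a / \<epsilon>r\<close>.\<close>

lemma small_deviation_at_last_stage:
  assumes "0 < \<epsilon>a" "0 < \<epsilon>r" "\<epsilon>r < 1" "0 < lam" "m > 0" "0 < \<alpha>"
    and m: "nu \<epsilon>a \<epsilon>r * ln (1 / \<alpha>) \<le> real m"
  shows "measure (poisson_pmf (real m * lam))
     {k. real k / real m \<le> lam - max \<epsilon>a (\<epsilon>r * lam)} \<le> \<alpha>"
proof -
  define a where "a = max \<epsilon>a (\<epsilon>r * lam)"
  define \<theta> where "\<theta> = - ln (1 - \<epsilon>r)"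
  have \<theta>: "\<epsilon>r \<le> \<theta>" "exp (- \<theta>) = 1 - \<epsilon>r"
    using assms(2,3) ln_le_minus_one[of "1 - \<epsilon>r"] by (auto simp: \<theta>_def)
  \<comment> \<open>In terms of \<open>\<theta>\<close>, the lower entropy
    \<open>(1 - \<epsilon>r) * ln (1 - \<epsilon>r) + \<epsilon>r\<close> is
    \<open>\<epsilon>r * \<theta> - (\<theta> - \<epsilon>r)\<close>.\<close>
  have ent: "0 < (1 + \<epsilon>r) * ln (1 + \<epsilon>r) - \<epsilon>r"
     "(1 + \<epsilon>r) * ln (1 + \<epsilon>r) - \<epsilon>r \<le> \<epsilon>r * \<theta> - (\<theta> - \<epsilon>r)"
    using ln_entropy_le[OF assms(2,3)] ln_one_plus_entropy_pos[OF assms(2)]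
    by (auto simp: \<theta>_def algebra_simps)
  have "1 / nu \<epsilon>a \<epsilon>r \<le> \<epsilon>a / \<epsilon>r * (\<epsilon>r * \<theta> - (\<theta> - \<epsilon>r))"
    unfolding inverse_nu(1)[OF assms(1,2)] using ent assms(1,2) by (intro mult_left_mono) auto
  also have "\<dots> \<le> \<theta> * a - lam * (\<theta> - \<epsilon>r)"
  proof (cases "\<epsilon>a / \<epsilon>r \<le> lam")
    case True
    have "\<epsilon>a / \<epsilon>r * (\<epsilon>r * \<theta> - (\<theta> - \<epsilon>r)) \<le> lam * (\<epsilon>r * \<theta> - (\<theta> - \<epsilon>r))"
      using True ent by (intro mult_right_mono) auto
    also have "\<dots> = \<theta> * (\<epsilon>r * lam) - lam * (\<theta> - \<epsilon>r)" by (simp add: algebra_simps)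
    also have "\<dots> \<le> \<theta> * a - lam * (\<theta> - \<epsilon>r)"
      using \<theta> assms(2) by (simp add: a_def)
    finally show ?thesis .
  next
    case False
    have "\<epsilon>a / \<epsilon>r * (\<epsilon>r * \<theta> - (\<theta> - \<epsilon>r)) = \<theta> * \<epsilon>a - \<epsilon>a / \<epsilon>r * (\<theta> - \<epsilon>r)"
      using assms(2) by (simp add: field_simps)
    also have "\<dots> \<le> \<theta> * \<epsilon>a - lam * (\<theta> - \<epsilon>r)"
      using False \<theta> mult_right_mono[of lam "\<epsilon>a / \<epsilon>r" "\<theta> - \<epsilon>r"] by auto
    also have "\<dots> \<le> \<theta> * a - lam * (\<theta> - \<epsilon>r)"
      using \<theta> assms(2) by (simp add: a_def)
    finally show ?thesis .
  qed
  finally have rate: "1 / nu \<epsilon>a \<epsilon>r \<le> \<theta> * a - lam * (\<theta> - \<epsilon>r)" .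
  have "measure (poisson_pmf (real m * lam)) {k. real k / real m \<le> lam - a}
      \<le> exp (\<theta> * (real m * (lam - a))) * exp (real m * lam * ((1 - \<epsilon>r) - 1))"
  proof (rule poisson_chernoff)
    fix k assume "k \<in> {k. real k / real m \<le> lam - a}"
    then have "real k \<le> real m * (lam - a)" using assms(5) by (simp add: field_simps)
    then have "\<theta> * real k \<le> \<theta> * (real m * (lam - a))"
      using \<theta> assms(2) by (intro mult_left_mono) auto
    then have "1 \<le> exp (\<theta> * (real m * (lam - a))) * exp (real k * - \<theta>)"
      by (simp add: exp_add[symmetric] mult.commute)
    then show "1 \<le> exp (\<theta> * (real m * (lam - a))) * (1 - \<epsilon>r) ^ k"
      unfolding exp_of_nat_mult \<theta>(2) .
  qed (use assms in auto)
  also have "\<dots> = exp (- (real m * (\<theta> * a - lam * (\<theta> - \<epsilon>r))))"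
    by (simp add: exp_add[symmetric] algebra_simps)
  also have "\<dots> \<le> \<alpha>"
    by (rule exp_le_of_sample_size[OF inverse_nu(2)[OF assms(1,2)] assms(6) m rate])
  finally show ?thesis by (simp add: a_def)
qed

section \<open>The stages\<close>

text \<open>From \<open>ln (1 + \<epsilon>r) \<le> \<epsilon>r\<close> the entropy is at most the
  square of \<open>\<epsilon>r\<close>, so the denominator of \<open>nu\<close> is below its
  numerator.\<close>

lemma one_less_nu:
  assumes "0 < \<epsilon>a" "\<epsilon>a < 1" "0 < \<epsilon>r" "\<epsilon>r < 1"
  shows "1 < nu \<epsilon>a \<epsilon>r"
proof -
  have "(1 + \<epsilon>r) * ln (1 + \<epsilon>r) \<le> (1 + \<epsilon>r) * \<epsilon>r"
    using assms ln_add_one_self_le_self[of \<epsilon>r] by (intro mult_left_mono) auto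
  then have h: "(1 + \<epsilon>r) * ln (1 + \<epsilon>r) - \<epsilon>r \<le> \<epsilon>r * \<epsilon>r" by (simp add: algebra_simps)
  have "\<epsilon>a * ((1 + \<epsilon>r) * ln (1 + \<epsilon>r) - \<epsilon>r) < 1 * ((1 + \<epsilon>r) * ln (1 + \<epsilon>r) - \<epsilon>r)"
    using assms ln_one_plus_entropy_pos[of \<epsilon>r] by (intro mult_strict_right_mono) auto
  also have "\<dots> \<le> \<epsilon>r * \<epsilon>r" using h by simp
  also have "\<dots> < \<epsilon>r" using assms by simp
  finally show ?thesis
    using assms ln_one_plus_entropy_pos[of \<epsilon>r] by (simp add: nu_def)
qed

lemma sample_sizes_pos:
  assumes "0 < \<epsilon>a" "0 < \<epsilon>r" "0 < \<zeta> * \<delta>" "\<zeta> * \<delta> < 1" and "m \<in> sample_sizes \<epsilon>a \<epsilon>r \<delta> \<zeta> \<rho>"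
  shows "0 < m"
  using assms inverse_nu(2)[OF assms(1,2)] by (auto simp: sample_sizes_def)

text \<open>The index \<open>i = tau\<close> has exponent 1. This relies on \<open>tau > 0\<close>,
  since division by zero would make the exponent 0.\<close>

lemma sample_sizes_last:
  assumes "0 < \<epsilon>a" "\<epsilon>a < 1" "0 < \<epsilon>r" "\<epsilon>r < 1" "0 < \<rho>"
  shows "\<exists>m\<in>sample_sizes \<epsilon>a \<epsilon>r \<delta> \<zeta> \<rho>. nu \<epsilon>a \<epsilon>r * ln (1 / (\<zeta> * \<delta>)) \<le> real m"
proof -
  have nu: "1 < nu \<epsilon>a \<epsilon>r" using assms by (intro one_less_nu)
  then have "0 < ln (nu \<epsilon>a \<epsilon>r) / ln (1 + \<rho>)" using assms by simp
  then have tau: "0 < tau \<epsilon>a \<epsilon>r \<rho>" by (simp add: tau_def)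
  have "nat \<lceil>nu \<epsilon>a \<epsilon>r * ln (1 / (\<zeta> * \<delta>))\<rceil> \<in> sample_sizes \<epsilon>a \<epsilon>r \<delta> \<zeta> \<rho>"
    unfolding sample_sizes_def using tau nu
    by (intro image_eqI[where x = "tau \<epsilon>a \<epsilon>r \<rho>"]) auto
  then show ?thesis using real_nat_ceiling_ge by blast
qed

text \<open>The disjunction isolates the default: only stage \<open>s\<close> can be final while its
  conditions fail.\<close>

lemma final_stage_cases:
  assumes "1 \<le> s"
  shows "final_stage s D \<in> {1..s}" and "final_stage s D = s \<or> D (final_stage s D)"
proof -
  have "final_stage s D \<in> {1..s} \<and> D (final_stage s D)" if "\<exists>l\<in>{1..s}. D l"
    unfolding final_stage_def if_P[OF that] by (rule LeastI_ex) (use that in blast)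
  moreover have "final_stage s D = s" if "\<not> (\<exists>l\<in>{1..s}. D l)"
    using that by (auto simp: final_stage_def)
  ultimately show "final_stage s D \<in> {1..s}" "final_stage s D = s \<or> D (final_stage s D)"
    using assms by (metis atLeastAtMost_iff order_refl)+
qed

lemma measurable_final_stage:
  assumes [measurable]: "\<And>l. Measurable.pred M (D l)"
  shows "(\<lambda>\<omega>. final_stage s (\<lambda>l. D l \<omega>)) \<in> measurable M (count_space UNIV)"
  unfolding final_stage_def by measurable

section \<open>The coverage probability\<close>

theorem theorem5:
  fixes \<epsilon>a \<epsilon>r \<delta> \<zeta> \<rho> lam :: real
    and n :: "nat \<Rightarrow> nat" and s :: nat
    and M :: "'a measure" and X :: "nat \<Rightarrow> 'a \<Rightarrow> nat"
  assumes "0 < \<epsilon>a" "\<epsilon>a < 1" "0 < \<epsilon>r" "\<epsilon>r < 1" "0 < \<delta>" "\<delta> < 1" "\<zeta> > 0" "\<rho> > 0"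
    and stages: "strict_mono_on {1..s} n" "n ` {1..s} = sample_sizes \<epsilon>a \<epsilon>r \<delta> \<zeta> \<rho>"
    and "lam > 0"
    and "prob_space M"
    and indep: "prob_space.indep_vars M (\<lambda>_. count_space UNIV) X {1..}"
    and poisson: "\<And>i. i \<ge> 1 \<Longrightarrow> distr M (count_space UNIV) (X i) = measure_pmf (poisson_pmf lam)"
    and zeta_le: "\<zeta> \<le> 1 / (2 * (real (tau \<epsilon>a \<epsilon>r \<rho>) + 1))"
  shows "measure M {\<omega> \<in> space M.
           let est = sample_mean X (final_size \<epsilon>a \<epsilon>r \<delta> \<zeta> n s X \<omega>) \<omega>
           in \<bar>est - lam\<bar> < \<epsilon>a \<or> \<bar>est - lam\<bar> < \<epsilon>r * lam} \<ge> 1 - \<delta>"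
proof -
  interpret prob_space M by fact
  define \<alpha> where "\<alpha> = \<zeta> * \<delta>"
  define \<tau> where "\<tau> = tau \<epsilon>a \<epsilon>r \<rho>"
  define a where "a = max \<epsilon>a (\<epsilon>r * lam)"
  define N where "N = (\<lambda>\<omega>. final_stage s (\<lambda>l. stop_cond \<epsilon>a \<epsilon>r \<delta> \<zeta> X (n l) \<omega>))"
  have \<zeta>: "2 * (real \<tau> + 1) * \<zeta> \<le> 1"
    using zeta_le by (simp add: \<tau>_def field_simps)
  \<comment> \<open>The bound on \<open>\<zeta>\<close> also yields \<open>\<alpha> < 1\<close>, so
    that \<open>ln (1 / \<alpha>)\<close> and with it every sample size is positive.\<close>
  have "1 * \<zeta> \<le> 2 * (real \<tau> + 1) * \<zeta>"
    using \<open>\<zeta> > 0\<close> by (intro mult_right_mono) auto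
  with \<zeta> have "\<zeta> \<le> 1" by simp
  then have "\<zeta> * \<delta> \<le> 1 * \<delta>"
    using \<open>0 < \<delta>\<close> by (intro mult_right_mono) auto
  then have \<alpha>: "0 < \<alpha>" "\<alpha> < 1"
    unfolding \<alpha>_def using \<open>\<zeta> > 0\<close> \<open>0 < \<delta>\<close> \<open>\<delta> < 1\<close> by (simp, linarith)
  have n_pos: "0 < n l" if "l \<in> {1..s}" for l
  proof -
    have "n l \<in> sample_sizes \<epsilon>a \<epsilon>r \<delta> \<zeta> \<rho>"
      using that stages(2) by blast
    then show ?thesis
      using \<alpha> assms(1,3) sample_sizes_pos unfolding \<alpha>_def by blast
  qed
  obtain l where l: "l \<in> {1..s}" "nu \<epsilon>a \<epsilon>r * ln (1 / \<alpha>) \<le> real (n l)"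
    using sample_sizes_last[of \<epsilon>a \<epsilon>r \<rho> \<delta> \<zeta>] assms(1-4,8) stages(2)[symmetric]
    by (auto simp: \<alpha>_def)
  have "n l \<le> n s"
    using l(1) strict_mono_on_leD[OF stages(1), of l s] by auto
  with l(2) have n_s: "nu \<epsilon>a \<epsilon>r * ln (1 / \<alpha>) \<le> real (n s)" by linarith
  have s: "1 \<le> s" using l(1) by simp
  \<comment> \<open>Different indices \<open>i\<close> may give the same ceiling, so the number of
    stages is only bounded by \<open>\<tau> + 1\<close>.\<close>
  have "s = card (n ` {1..s})"
    using stages(1) by (subst card_image) (auto intro: strict_mono_on_imp_inj_on)
  also have "\<dots> \<le> card {0..\<tau>}"
    unfolding stages(2) sample_sizes_def \<tau>_def by (rule card_image_le) simp
  finally have s_le: "real s \<le> real \<tau> + 1" by simp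

  \<comment> \<open>The disjunct \<open>l = s\<close> drops the stopping condition at the last
    stage, where sampling may end by default.\<close>
  define hi where "hi = (\<lambda>l. {k. lam + a \<le> real k / real (n l) \<and>
     (l = s \<or> 1 - \<alpha> \<le> S_P 0 (int k - 1) (n l) (lower_limit \<epsilon>a \<epsilon>r (real k / real (n l))))})"
  define lo where "lo = (\<lambda>l. {k. real k / real (n l) \<le> lam - a \<and>
     (l = s \<or> S_P 0 (int k) (n l) (upper_limit \<epsilon>a \<epsilon>r (real k / real (n l))) \<le> \<alpha>)})"
  have hi: "measure (poisson_pmf (real (n l) * lam)) (hi l) \<le> \<alpha>" if "l \<in> {1..s}" for l
  proof (cases "l = s")
    case True
    then show ?thesis
      using large_deviation_at_last_stage[OF assms(1,3) \<open>lam > 0\<close> n_pos[OF that] \<alpha>(1)] n_s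
      by (simp add: hi_def a_def)
  next
    case False
    then show ?thesis
      using large_deviation_with_stop_cond[of \<alpha> \<epsilon>r lam "n l" \<epsilon>a] assms(3,11) \<alpha>(1) n_pos[OF that]
      by (simp add: hi_def a_def)
  qed
  have lo: "measure (poisson_pmf (real (n l) * lam)) (lo l) \<le> \<alpha>" if "l \<in> {1..s}" for l
  proof (cases "l = s")
    case True
    then show ?thesis
      using small_deviation_at_last_stage[OF assms(1,3,4) \<open>lam > 0\<close> n_pos[OF that] \<alpha>(1)] n_s
      by (simp add: lo_def a_def)
  next
    case False
    then show ?thesis
      using small_deviation_with_stop_cond[of \<alpha> \<epsilon>a \<epsilon>r "n l" lam] assms(1,4) \<alpha>(1) n_pos[OF that]
      by (simp add: lo_def a_def)
  qed

  have rv: "sample_sum X m \<in> measurable M (count_space UNIV)" for m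
    using measurable_sample_sum[OF indep] .
  \<comment> \<open>Each \<open>E l\<close> concerns the fixed sample size \<open>n l\<close>, whose
    sum is exactly Poisson; the random stopping stage does not enter.\<close>
  define E where "E = (\<lambda>l. {\<omega> \<in> space M. sample_sum X (n l) \<omega> \<in> hi l \<union> lo l})"
  have E_sets: "E l \<in> events" for l
    using rv[of "n l"] unfolding E_def by measurable
  have E: "prob (E l) \<le> 2 * \<alpha>" if "l \<in> {1..s}" for l
  proof -
    have "prob (E l) = measure (distr M (count_space UNIV) (sample_sum X (n l))) (hi l \<union> lo l)"
      using rv[of "n l"]
      by (subst measure_distr) (auto simp: E_def intro!: arg_cong[where f = prob])
    also have "\<dots> = measure (poisson_pmf (real (n l) * lam)) (hi l \<union> lo l)"
      using distr_sample_sum[OF indep poisson \<open>lam > 0\<close> n_pos[OF that]] by simp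
    also have "\<dots> \<le> measure (poisson_pmf (real (n l) * lam)) (hi l) +
        measure (poisson_pmf (real (n l) * lam)) (lo l)"
      by (intro measure_Un_le) auto
    finally show ?thesis using hi[OF that] lo[OF that] by simp
  qed
  let ?G = "{\<omega> \<in> space M.
           let est = sample_mean X (final_size \<epsilon>a \<epsilon>r \<delta> \<zeta> n s X \<omega>) \<omega>
           in \<bar>est - lam\<bar> < \<epsilon>a \<or> \<bar>est - lam\<bar> < \<epsilon>r * lam}"
  have sub: "space M - (\<Union>l\<in>{1..s}. E l) \<subseteq> ?G"
  proof (rule ccontr)
    assume "\<not> ?thesis"
    then obtain \<omega> where \<omega>: "\<omega> \<in> space M" "\<And>l. l \<in> {1..s} \<Longrightarrow> \<omega> \<notin> E l" "\<omega> \<notin> ?G" by blast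
    define l where "l = N \<omega>"
    define k where "k = sample_sum X (n l) \<omega>"
    have l: "l \<in> {1..s}" "l = s \<or> stop_cond \<epsilon>a \<epsilon>r \<delta> \<zeta> X (n l) \<omega>"
      using final_stage_cases[OF s] unfolding l_def N_def by blast+
    have "a \<le> \<bar>real k / real (n l) - lam\<bar>"
      using \<omega>(1,3) by (auto simp: Let_def sample_mean_def final_size_def a_def k_def l_def N_def not_less)
    \<comment> \<open>The sign of the deviation decides between \<open>hi\<close> and
      \<open>lo\<close>, and each takes its own half of the stopping rule.\<close>
    then have "k \<in> hi l \<union> lo l"
      using l(2) by (auto simp: hi_def lo_def k_def stop_cond_def sample_mean_def \<alpha>_def abs_if
          split: if_splits)
    with \<omega>(1,2) l(1) show False by (auto simp: E_def k_def)
  qed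
  have pred: "Measurable.pred M (\<lambda>\<omega>. P (sample_sum X m \<omega>))" for P :: "nat \<Rightarrow> bool" and m
    using measurable_compose[OF rv, of P] by simp
  have D: "Measurable.pred M (stop_cond \<epsilon>a \<epsilon>r \<delta> \<zeta> X (n l))" for l
    using pred[of "\<lambda>k. 1 - \<zeta> * \<delta> \<le> S_P 0 (int k - 1) (n l) (lower_limit \<epsilon>a \<epsilon>r (real k / real (n l))) \<and>
      S_P 0 (int k) (n l) (upper_limit \<epsilon>a \<epsilon>r (real k / real (n l))) \<le> \<zeta> * \<delta>" "n l"]
    by (simp add: stop_cond_def[abs_def] sample_mean_def)
  have N: "N \<in> measurable M (count_space UNIV)"
    unfolding N_def by (rule measurable_final_stage[OF D])
  \<comment> \<open>The final stage takes countably many values, so measurability reduces to fixed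
    stages.\<close>
  have G: "Measurable.pred M (\<lambda>\<omega>. \<bar>sample_mean X (n (N \<omega>)) \<omega> - lam\<bar> < \<epsilon>a \<or>
      \<bar>sample_mean X (n (N \<omega>)) \<omega> - lam\<bar> < \<epsilon>r * lam)"
  proof (rule measurable_compose_countable[OF _ N])
    fix l
    show "Measurable.pred M (\<lambda>\<omega>. \<bar>sample_mean X (n l) \<omega> - lam\<bar> < \<epsilon>a \<or>
        \<bar>sample_mean X (n l) \<omega> - lam\<bar> < \<epsilon>r * lam)"
      using pred[of "\<lambda>k. \<bar>real k / real (n l) - lam\<bar> < \<epsilon>a \<or> \<bar>real k / real (n l) - lam\<bar> < \<epsilon>r * lam" "n l"]
      by (simp add: sample_mean_def)
  qed
  have "prob (\<Union>l\<in>{1..s}. E l) \<le> (\<Sum>l\<in>{1..s}. prob (E l))"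
    using E_sets by (intro finite_measure_subadditive_finite) auto
  also have "\<dots> \<le> real s * (2 * \<alpha>)"
    using sum_bounded_above[of "{1..s}" "\<lambda>l. prob (E l)" "2 * \<alpha>"] E by simp
  also have "\<dots> \<le> (real \<tau> + 1) * (2 * \<alpha>)"
    using s_le \<alpha> by (intro mult_right_mono) auto
  \<comment> \<open>The factor 2 counts the two directions of deviation and
    \<open>\<tau> + 1\<close> the stages; their product with \<open>\<zeta>\<close> is at most 1 by
    hypothesis.\<close>
  also have "\<dots> = 2 * (real \<tau> + 1) * \<zeta> * \<delta>"
    by (simp add: \<alpha>_def)
  also have "\<dots> \<le> 1 * \<delta>"
    using \<zeta> \<open>0 < \<delta>\<close> by (intro mult_right_mono) auto
  finally have "1 - \<delta> \<le> 1 - prob (\<Union>l\<in>{1..s}. E l)" by simp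
  also have "\<dots> = prob (space M - (\<Union>l\<in>{1..s}. E l))"
    using E_sets by (intro prob_compl[symmetric]) auto
  also have "\<dots> \<le> prob ?G"
  proof (rule finite_measure_mono[OF sub])
    show "?G \<in> events"
      using predE[OF G] by (simp add: final_size_def N_def Let_def)
  qed
  finally show ?thesis .
qed

end
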